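(* For all $M\in\mathbb N$, all $d\in\mathbb Z$ and all $0\le T\le M$, $$\gamma(d,T,M+1)=\gamma(-d,M-T,M+1).$$
   Context: Fix integers $M\ge1$, $q\ge2$. The augmented state set is $\overline S=\{(b_1,\dots,b_M,d;T,t): b_m,d,T\in\mathbb Z,\ 1\le t\le M+1,\ d+T+\sum_{m=1}^M b_m=0\}$, the BDM state set is $S=\{s\in\overline S:0\le T\le M\}$, and $S(T_0,t_0,d_0)=\{s\in S: T=T_0,t=t_0,d=d_0\}$; initial state $s_0=(0,\dots,0,0;0,M+1)$. The BDM is the Markov chain on $S$ with transitions from $s=(b_1,\dots,b_M,d;T,t)$: if $t\le M$ and $b_t>d$, with probability $(q-1)/q$ to $(b_1,\dots,b_{t-1},d,b_{t+1},\dots,b_M,b_t;T,t+1)$ and with probability $1/q$ to $(b_1,\dots,b_M,d;T,t+1)$; if $t\le M$ and $b_t\le d$, with probability 1 to $(b_1,\dots,b_M,d;T,t+1)$; if $t=M+1,T<M$, with probability 1 to $(b_1,\dots,b_M,d-1;T+1,1)$; if $t=M+1,T=M$, with probability 1 to $(b_1+1,\dots,b_M+1,d;0,1)$. Let $\mu_0$ be the point mass at $s_0$, $\mu_{\tau+1}(s')=\sum_s\mu_\tau(s)p(s,s')$, and $\mu_\infty(s)=\limsup_{\tau\to\infty}\mu_\tau(s)$. Define $\gamma(d,T,t)=\sum_{s\in S(T,t,d)}\mu_\infty(s)$. *)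

theory Defs
  imports "HOL-Probability.Probability"
begin

text \<open>A state (b_1..b_M, d; T, t) is represented as (bs, d, T, t) where
  bs is an int list of length M with b_m = bs ! (m - 1).\<close>

type_synonym bdm_state = "int list \<times> int \<times> int \<times> nat"

definition bdm_aug_states :: "nat \<Rightarrow> bdm_state set" where
  "bdm_aug_states M = {(bs, d, T, t). length bs = M \<and> 1 \<le> t \<and> t \<le> M + 1 \<and>
      d + T + sum_list bs = 0}"

definition bdm_states :: "nat \<Rightarrow> bdm_state set" where
  "bdm_states M = {s \<in> bdm_aug_states M. 0 \<le> fst (snd (snd s)) \<and> fst (snd (snd s)) \<le> int M}"

definition bdm_states_fix :: "nat \<Rightarrow> int \<Rightarrow> nat \<Rightarrow> int \<Rightarrow> bdm_state set" where
  "bdm_states_fix M T0 t0 d0 = {s \<in> bdm_states M. s = (fst s, d0, T0, t0)}"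

definition bdm_init :: "nat \<Rightarrow> bdm_state" where
  "bdm_init M = (replicate M 0, 0, 0, M + 1)"

text \<open>One-step transition kernel (on states outside S it is irrelevant).\<close>
definition bdm_step :: "nat \<Rightarrow> nat \<Rightarrow> bdm_state \<Rightarrow> bdm_state pmf" where
  "bdm_step M q s = (case s of (bs, d, T, t) \<Rightarrow>
     if t \<le> M then
       (if bs ! (t - 1) > d then
          map_pmf (\<lambda>c. if c then (bs[t - 1 := d], bs ! (t - 1), T, t + 1) else (bs, d, T, t + 1))
                  (bernoulli_pmf ((real q - 1) / real q))
        else return_pmf (bs, d, T, t + 1))
     else if T < int M then return_pmf (bs, d - 1, T + 1, 1)
     else return_pmf (map (\<lambda>x. x + 1) bs, d, 0, 1))"

primrec bdm_dist :: "nat \<Rightarrow> nat \<Rightarrow> nat \<Rightarrow> bdm_state pmf" where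
  "bdm_dist M q 0 = return_pmf (bdm_init M)"
| "bdm_dist M q (Suc n) = bind_pmf (bdm_dist M q n) (bdm_step M q)"

definition bdm_mu :: "nat \<Rightarrow> nat \<Rightarrow> nat \<Rightarrow> bdm_state \<Rightarrow> real" where
  "bdm_mu M q n s = pmf (bdm_dist M q n) s"

definition bdm_mu_inf :: "nat \<Rightarrow> nat \<Rightarrow> bdm_state \<Rightarrow> ennreal" where
  "bdm_mu_inf M q s = limsup (\<lambda>n. ennreal (bdm_mu M q n s))"

definition bdm_gamma :: "nat \<Rightarrow> nat \<Rightarrow> int \<Rightarrow> int \<Rightarrow> nat \<Rightarrow> ennreal" where
  "bdm_gamma M q d T t = (\<Sum>\<^sub>\<infinity> s \<in> bdm_states_fix M T t d. bdm_mu_inf M q s)"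

end

(* Insert d into the word b_1 ... b_M just before b_t. In this encoding every transition with t <= M
   is reversible for the weight q^(-E), where E sums max (x_i - x_j) (x_j - x_i - 1) over i < j, and
   the two transitions at t = M + 1 (decrease the last letter by one and move it to the front, up to a
   translation) preserve E. Hence q^(-E) is stationary. It is summable on each phase of the period
   (M+1)^2, and the chain converges along phases, so mu_inf is a constant multiple of q^(-E). The
   symmetry now follows from the energy preserving bijection that negates and reverses the word,
   b |-> (-b_M - 1, ..., -b_1 - 1), d |-> -d. *)

theory Submission
  imports Defs "HOL-Number_Theory.Cong"
begin

section \<open>Convergence of a kernel to a periodic distribution\<close>

text \<open>The state space is infinite and the chain is periodic, so mass might escape and
  \<open>bdm_mu\<close> at a fixed state has no single limit. Escape is excluded by domination: the
  initial state has energy 0, hence positive mass under the normalised weight r on phase 0, so the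
  starting point mass is at most a constant multiple of r, and every transition preserves such a
  bound. One finite set therefore carries nearly all of the mass at every multiple of the period. On
  it a Doeblin argument works, provided that each state of phase 0 can reach the initial state in a
  whole number of periods; this reachability comes from lowering the energy as far as possible. The
  normalising constant has to agree across phases, because the mirror map replaces T by M - T and so
  may change the phase. It does agree: one step carries c q^(-E) on one phase to c q^(-E) on the
  next.\<close>

primrec iterate_kernel :: "('a \<Rightarrow> 'a pmf) \<Rightarrow> nat \<Rightarrow> 'a pmf \<Rightarrow> 'a pmf" where
  "iterate_kernel K 0 p = p"
| "iterate_kernel K (Suc n) p = bind_pmf (iterate_kernel K n p) K"

lemma iterate_kernel_add:
  "iterate_kernel K (m + n) p = iterate_kernel K n (iterate_kernel K m p)"
  by (induction n) auto

lemma iterate_kernel_bind: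
  "iterate_kernel K n p = bind_pmf p (\<lambda>x. iterate_kernel K n (return_pmf x))"
  by (induction n) (simp_all add: bind_return_pmf' bind_assoc_pmf)

lemma set_iterate_kernel_Suc:
  "y \<in> set_pmf (iterate_kernel K (Suc n) p) \<longleftrightarrow> (\<exists>x\<in>set_pmf (iterate_kernel K n p). y \<in> set_pmf (K x))"
  by simp

lemma set_iterate_kernel_add:
  assumes "y \<in> set_pmf (iterate_kernel K m (return_pmf x))"
    and "z \<in> set_pmf (iterate_kernel K n (return_pmf y))"
  shows "z \<in> set_pmf (iterate_kernel K (m + n) (return_pmf x))"
  unfolding iterate_kernel_add
  by (subst iterate_kernel_bind) (use assms in auto)

lemma iterate_kernel_periodic:
  assumes "iterate_kernel K L r = r"
  shows "iterate_kernel K (k * L) r = r"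
  by (induction k) (simp_all add: iterate_kernel_add assms)

lemma ennreal_pmf_bind_count_space:
  "ennreal (pmf (bind_pmf p K) y) = (\<integral>\<^sup>+x. ennreal (pmf p x) * ennreal (pmf (K x) y) \<partial>count_space UNIV)"
  unfolding ennreal_pmf_bind by (rule nn_integral_measure_pmf)

lemma pmf_bind_dominated:
  assumes "\<And>x. pmf p x \<le> C * pmf r x" and C: "C \<ge> 0"
  shows "pmf (bind_pmf p K) y \<le> C * pmf (bind_pmf r K) y"
proof -
  have "ennreal (pmf (bind_pmf p K) y) \<le> (\<integral>\<^sup>+x. ennreal C * (ennreal (pmf r x) * ennreal (pmf (K x) y)) \<partial>count_space UNIV)"
    unfolding ennreal_pmf_bind_count_space
    by (intro nn_integral_mono)
       (use assms in \<open>auto simp flip: ennreal_mult simp: mult.assoc[symmetric] intro!: ennreal_leI mult_right_mono\<close>)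
  also have "\<dots> = ennreal (C * pmf (bind_pmf r K) y)"
    using C by (simp add: nn_integral_cmult ennreal_pmf_bind_count_space ennreal_mult)
  finally show ?thesis using C by (simp add: ennreal_le_iff)
qed

text \<open>This bound serves as tightness: when \<open>r\<close> is periodic, a finite set with
  nearly all of the mass of \<open>r\<close> has nearly all of the mass of the running distribution
  at every multiple of the period.\<close>

lemma iterate_kernel_dominated:
  assumes "\<And>x. pmf p x \<le> C * pmf r x" and "C \<ge> 0"
  shows "pmf (iterate_kernel K n p) x \<le> C * pmf (iterate_kernel K n r) x"
  using assms by (induction n arbitrary: x) (auto intro!: pmf_bind_dominated)

text \<open>One minus the total variation distance of \<open>p\<close> and \<open>r\<close>.\<close>

definition overlap :: "'a pmf \<Rightarrow> 'a pmf \<Rightarrow> real" where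
  "overlap p r = enn2real (\<integral>\<^sup>+x. ennreal (min (pmf p x) (pmf r x)) \<partial>count_space UNIV)"

lemma nn_integral_min_pmf:
  "(\<integral>\<^sup>+x. ennreal (min (pmf p x) (pmf r x)) \<partial>count_space UNIV) = ennreal (overlap p r)"
  "overlap p r \<le> 1" "overlap p r \<ge> 0"
proof -
  have le: "(\<integral>\<^sup>+x. ennreal (min (pmf p x) (pmf r x)) \<partial>count_space UNIV) \<le> 1"
    unfolding nn_integral_pmf_eq_1[of p, symmetric] by (intro nn_integral_mono) (auto intro: ennreal_leI)
  then show eq: "(\<integral>\<^sup>+x. ennreal (min (pmf p x) (pmf r x)) \<partial>count_space UNIV) = ennreal (overlap p r)"
    unfolding overlap_def by (subst ennreal_enn2real) (auto simp: order_le_less_trans)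
  show "overlap p r \<ge> 0" by (simp add: overlap_def)
  from le show "overlap p r \<le> 1" by (simp add: eq ennreal_le_1)
qed

lemma overlap_commute: "overlap p r = overlap r p"
  by (simp add: overlap_def min.commute)

text \<open>Below \<open>p\<close>, the pointwise minimum leaves total room
  \<open>1 - overlap p r\<close>, and the excess of \<open>p\<close> over \<open>r\<close> at
  \<open>x\<close> has to fit into it.\<close>

lemma pmf_excess_le_overlap:
  "pmf p x - pmf r x \<le> 1 - overlap p r"
proof -
  let ?m = "\<lambda>x. min (pmf p x) (pmf r x)"
  have "ennreal (overlap p r) + ennreal (pmf p x - ?m x)
      = (\<integral>\<^sup>+y. ennreal (?m y) + ennreal (pmf p x - ?m x) * indicator {x} y \<partial>count_space UNIV)"
    by (simp add: nn_integral_add nn_integral_min_pmf nn_integral_cmult)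
  also have "\<dots> \<le> (\<integral>\<^sup>+y. ennreal (pmf p y) \<partial>count_space UNIV)"
    by (intro nn_integral_mono) (auto simp: indicator_def simp flip: ennreal_plus intro!: ennreal_leI)
  also have "\<dots> = ennreal 1" by (simp add: nn_integral_pmf_eq_1)
  finally have "overlap p r + (pmf p x - ?m x) \<le> 1"
    by (simp add: nn_integral_min_pmf ennreal_le_1 flip: ennreal_plus)
  then show ?thesis by linarith
qed

lemma abs_pmf_diff_le_overlap: "\<bar>pmf p x - pmf r x\<bar> \<le> 1 - overlap p r"
  using pmf_excess_le_overlap[of p x r] pmf_excess_le_overlap[of r x p] overlap_commute[of p r]
  by linarith

text \<open>A Doeblin-type minorization: the parts of \<open>p\<close> and \<open>r\<close> outside their minimum both send mass
  at least \<open>\<delta> (1 - overlap p r - e)\<close> to \<open>z\<close>, so the overlap grows by that amount.\<close>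

lemma pmf_bind_ge_min_part:
  assumes "finite F" and K: "\<And>x. x \<in> F \<Longrightarrow> \<delta> \<le> pmf (K x) z"
    and \<delta>: "\<delta> \<ge> 0" and e: "1 - e \<le> (\<Sum>x\<in>F. pmf p x)"
  shows "(\<integral>\<^sup>+x. ennreal (min (pmf p x) (pmf r x)) * ennreal (pmf (K x) z) \<partial>count_space UNIV)
      + ennreal (\<delta> * (1 - overlap p r - e)) \<le> ennreal (pmf (bind_pmf p K) z)"
proof -
  let ?m = "\<lambda>x. min (pmf p x) (pmf r x)"
  have m: "(\<Sum>x\<in>F. ?m x) \<le> overlap p r"
  proof -
    have "ennreal (\<Sum>x\<in>F. ?m x) = (\<integral>\<^sup>+x. ennreal (?m x) * indicator F x \<partial>count_space UNIV)"
      by (subst nn_integral_count_space'[of F]) (use assms in \<open>auto simp: sum_ennreal indicator_def intro!: sum.cong\<close>)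
    also have "\<dots> \<le> (\<integral>\<^sup>+x. ennreal (?m x) \<partial>count_space UNIV)"
      by (intro nn_integral_mono) (auto simp: indicator_def)
    finally show ?thesis by (simp add: nn_integral_min_pmf)
  qed
  have "ennreal (\<delta> * (1 - overlap p r - e)) \<le> ennreal (\<Sum>x\<in>F. (pmf p x - ?m x) * \<delta>)"
    using e m \<delta> by (intro ennreal_leI) (simp add: sum_subtractf mult.commute mult_left_mono flip: sum_distrib_left sum_distrib_right)
  also have "\<dots> = (\<integral>\<^sup>+x. ennreal ((pmf p x - ?m x) * \<delta>) * indicator F x \<partial>count_space UNIV)"
    by (subst nn_integral_count_space'[of F]) (use assms in \<open>auto simp: sum_ennreal indicator_def intro!: sum.cong\<close>)
  also have "\<dots> \<le> (\<integral>\<^sup>+x. ennreal ((pmf p x - ?m x) * pmf (K x) z) \<partial>count_space UNIV)"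
    by (intro nn_integral_mono) (auto simp: indicator_def intro!: ennreal_leI mult_left_mono K)
  finally have "(\<integral>\<^sup>+x. ennreal (?m x) * ennreal (pmf (K x) z) \<partial>count_space UNIV)
        + ennreal (\<delta> * (1 - overlap p r - e))
      \<le> (\<integral>\<^sup>+x. ennreal (?m x) * ennreal (pmf (K x) z) \<partial>count_space UNIV)
        + (\<integral>\<^sup>+x. ennreal ((pmf p x - ?m x) * pmf (K x) z) \<partial>count_space UNIV)"
    by (rule add_left_mono)
  also have "\<dots> = (\<integral>\<^sup>+x. ennreal (?m x) * ennreal (pmf (K x) z) + ennreal ((pmf p x - ?m x) * pmf (K x) z) \<partial>count_space UNIV)"
    by (simp add: nn_integral_add)
  also have "\<dots> = ennreal (pmf (bind_pmf p K) z)"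
    unfolding ennreal_pmf_bind_count_space
    by (intro nn_integral_cong) (auto simp: min_def algebra_simps mult_right_mono simp flip: ennreal_mult ennreal_plus)
  finally show ?thesis .
qed

text \<open>\<open>K\<close> carries the common part of \<open>p\<close> and \<open>r\<close> to a
  measure below both images, with its total mass unchanged by Fubini. The contributions of the two
  remainders at \<open>z\<close> come on top.\<close>

lemma overlap_bind_increase:
  fixes K :: "'a::countable \<Rightarrow> 'a pmf"
  assumes "finite F" and "\<And>x. x \<in> F \<Longrightarrow> \<delta> \<le> pmf (K x) z"
    and "\<delta> \<ge> 0" and "1 - e \<le> (\<Sum>x\<in>F. pmf p x)" "1 - e \<le> (\<Sum>x\<in>F. pmf r x)"
  shows "overlap p r + \<delta> * (1 - overlap p r - e) \<le> overlap (bind_pmf p K) (bind_pmf r K)"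
proof -
  let ?m = "\<lambda>x. min (pmf p x) (pmf r x)"
  let ?b = "ennreal (\<delta> * (1 - overlap p r - e))"
  let ?mK = "\<lambda>y. \<integral>\<^sup>+x. ennreal (?m x) * ennreal (pmf (K x) y) \<partial>count_space UNIV"
  interpret pair_sigma_finite "count_space (UNIV :: 'a set)" "count_space (UNIV :: 'a set)"
    by (intro pair_sigma_finite.intro sigma_finite_measure_count_space)
  have mK_le: "?mK y \<le> ennreal (min (pmf (bind_pmf p K) y) (pmf (bind_pmf r K) y))" for y
    unfolding min_def ennreal_pmf_bind_count_space
    by (auto simp: ennreal_pmf_bind_count_space intro!: nn_integral_mono mult_right_mono ennreal_leI)
  have z_le: "?mK z + ?b \<le> ennreal (min (pmf (bind_pmf p K) z) (pmf (bind_pmf r K) z))"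
    using pmf_bind_ge_min_part[of F \<delta> K z e p r] pmf_bind_ge_min_part[of F \<delta> K z e r p] assms
    unfolding overlap_commute[of r p] min.commute[of "pmf r _"]
    by (cases "pmf (bind_pmf p K) z \<le> pmf (bind_pmf r K) z") (simp_all only: min.absorb1 min.absorb2 linear nle_le if_True)
  have "(\<integral>\<^sup>+y. ?mK y \<partial>count_space UNIV)
      = (\<integral>\<^sup>+x. \<integral>\<^sup>+y. ennreal (?m x) * ennreal (pmf (K x) y) \<partial>count_space UNIV \<partial>count_space UNIV)"
    by (rule Fubini') (simp add: pair_measure_countable)
  also have "\<dots> = ennreal (overlap p r)"
    by (simp add: nn_integral_cmult nn_integral_pmf_eq_1 nn_integral_min_pmf)
  finally have "ennreal (overlap p r) + ?b
      = (\<integral>\<^sup>+y. ?mK y + ?b * indicator {z} y \<partial>count_space UNIV)"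
    by (simp add: nn_integral_add nn_integral_cmult)
  also have "\<dots> \<le> (\<integral>\<^sup>+y. ennreal (min (pmf (bind_pmf p K) y) (pmf (bind_pmf r K) y)) \<partial>count_space UNIV)"
    by (intro nn_integral_mono) (use mK_le z_le in \<open>auto simp: indicator_def\<close>)
  also have "\<dots> = ennreal (overlap (bind_pmf p K) (bind_pmf r K))"
    by (rule nn_integral_min_pmf)
  finally show ?thesis
    \<comment> \<open>A negative increment is truncated to 0 by \<open>ennreal\<close>; the bound
      obtained is then stronger than the claim.\<close>
    by (cases "\<delta> * (1 - overlap p r - e) \<ge> 0")
       (simp_all add: nn_integral_min_pmf ennreal_neg flip: ennreal_plus)
qed

lemma prob_dominated:
  assumes "\<And>x. pmf p x \<le> C * pmf r x" and C: "C \<ge> 0"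
  shows "measure_pmf.prob p A \<le> C * measure_pmf.prob r A"
proof -
  have "ennreal (measure_pmf.prob p A) = (\<integral>\<^sup>+x. ennreal (pmf p x) \<partial>count_space A)"
    by (simp add: nn_integral_pmf measure_pmf.emeasure_eq_measure)
  also have "\<dots> \<le> (\<integral>\<^sup>+x. ennreal C * ennreal (pmf r x) \<partial>count_space A)"
    using assms by (intro nn_integral_mono) (auto simp flip: ennreal_mult intro!: ennreal_leI)
  also have "\<dots> = ennreal (C * measure_pmf.prob r A)"
    using C by (simp add: nn_integral_cmult nn_integral_pmf measure_pmf.emeasure_eq_measure ennreal_mult)
  finally show ?thesis using C by (simp add: ennreal_le_iff)
qed

lemma finite_subset_almost_all_mass:
  fixes r :: "'a::countable pmf"
  assumes "e > 0"
  obtains F where "finite F" "F \<subseteq> set_pmf r" "measure_pmf.prob r (- F) < e"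
proof -
  let ?A = "\<lambda>n. {x :: 'a. to_nat x < n}"
  have "(\<lambda>n. measure_pmf.prob r (?A n)) \<longlonglongrightarrow> measure_pmf.prob r (\<Union>n. ?A n)"
    by (rule measure_pmf.finite_Lim_measure_incseq) (auto simp: incseq_def)
  moreover have "(\<Union>n. ?A n) = UNIV" by auto
  ultimately have "(\<lambda>n. measure_pmf.prob r (?A n)) \<longlonglongrightarrow> 1" by simp
  then have "\<forall>\<^sub>F n in sequentially. measure_pmf.prob r (?A n) > 1 - e"
    using assms by (intro order_tendstoD) auto
  then obtain n where n: "measure_pmf.prob r (?A n) > 1 - e"
    by (auto simp: eventually_sequentially)
  show thesis
  proof (rule that[of "?A n \<inter> set_pmf r"])
    have "?A n = to_nat -` {..<n}" by auto
    then show "finite (?A n \<inter> set_pmf r)" by (simp add: finite_vimageI)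
    have "measure_pmf.prob r (- (?A n \<inter> set_pmf r)) = 1 - measure_pmf.prob r (?A n \<inter> set_pmf r)"
      by (subst measure_pmf.prob_compl[symmetric]) (auto simp: Compl_eq_Diff_UNIV)
    then show "measure_pmf.prob r (- (?A n \<inter> set_pmf r)) < e"
      using n by (simp add: measure_Int_set_pmf)
  qed auto
qed

text \<open>If the overlap stayed below 1 by a gap \<eta>, a fixed finite set would hold all but
  \<eta>/2 of both distributions at each multiple of \<open>L\<close>, and all its points would hit
  \<open>z\<close> at one common time. Each such stretch would raise the overlap by the same
  positive amount, contradicting its convergence.\<close>

lemma iterate_kernel_tendsto_periodic:
  fixes K :: "'a::countable \<Rightarrow> 'a pmf"
  assumes per: "iterate_kernel K L r = r" and L: "L > 0"
    and dom: "\<And>x. pmf p x \<le> C * pmf r x" and C: "C \<ge> 0"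
    and reach: "\<And>x. x \<in> set_pmf r \<Longrightarrow> \<exists>k. z \<in> set_pmf (iterate_kernel K (k * L) (return_pmf x))"
    and loop: "z \<in> set_pmf (iterate_kernel K L (return_pmf z))"
  shows "(\<lambda>n. pmf (iterate_kernel K n p) x - pmf (iterate_kernel K n r) x) \<longlonglongrightarrow> 0"
proof -
  define Ov where "Ov n = overlap (iterate_kernel K n p) (iterate_kernel K n r)" for n
  have "Ov n \<le> Ov (Suc n)" for n
    \<comment> \<open>The empty set with \<delta> = 0 turns the growth estimate into plain
      monotonicity.\<close>
    unfolding Ov_def using overlap_bind_increase[of "{}" 0 K z 1] by simp
  then have "incseq Ov" by (rule incseq_SucI)
  moreover have "Ov n \<le> 1" for n by (simp add: Ov_def nn_integral_min_pmf)
  ultimately obtain l where lim: "Ov \<longlonglongrightarrow> l" and le: "\<And>n. Ov n \<le> l"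
    using incseq_convergent by blast
  have "l \<le> 1" using lim \<open>\<And>n. Ov n \<le> 1\<close> by (meson LIMSEQ_le_const2)
  have "l = 1"
  proof (rule ccontr)
    assume "l \<noteq> 1"
    define \<eta> where "\<eta> = 1 - l"
    have "\<eta> > 0" using \<open>l \<noteq> 1\<close> \<open>l \<le> 1\<close> by (simp add: \<eta>_def)
    \<comment> \<open>The factor \<open>C + 1\<close> exceeds both \<open>C\<close>, the loss for
      the dominated distribution, and 1, the loss for \<open>r\<close> itself.\<close>
    obtain F where F: "finite F" "F \<subseteq> set_pmf r" "measure_pmf.prob r (- F) < \<eta> / (2 * (C + 1))"
      using finite_subset_almost_all_mass[of "\<eta> / (2 * (C + 1))" r] \<open>\<eta> > 0\<close> C by auto
    have rF: "(C + 1) * measure_pmf.prob r (- F) \<le> \<eta> / 2"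
      using F(3) C by (simp add: field_simps)
    have mass_F: "1 - \<eta> / 2 \<le> (\<Sum>x\<in>F. pmf p' x)" if "measure_pmf.prob p' (- F) \<le> (C + 1) * measure_pmf.prob r (- F)" for p'
      using that rF measure_pmf.prob_compl[of F p'] F(1)
      by (simp add: measure_measure_pmf_finite Compl_eq_Diff_UNIV)
    have "\<exists>k. \<forall>x\<in>F. z \<in> set_pmf (iterate_kernel K (k * L) (return_pmf x))"
    proof -
      obtain k where k: "\<And>x. x \<in> F \<Longrightarrow> z \<in> set_pmf (iterate_kernel K (k x * L) (return_pmf x))"
        using reach F(2) by (metis subsetD)
      have loops: "z \<in> set_pmf (iterate_kernel K (j * L) (return_pmf z))" for j
      proof (induction j)
        case (Suc j)
        show ?case using set_iterate_kernel_add[OF loop Suc] by (simp add: algebra_simps)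
      qed simp
      \<comment> \<open>Loops at \<open>z\<close> pad the different hitting times to their
        maximum.\<close>
      define m where "m = Max (k ` F)"
      have "z \<in> set_pmf (iterate_kernel K (m * L) (return_pmf x))" if "x \<in> F" for x
      proof -
        have "k x \<le> m" using that F(1) by (simp add: m_def)
        then have "k x * L + (m - k x) * L = m * L" by (simp flip: add_mult_distrib)
        then show ?thesis
          using set_iterate_kernel_add[OF k[OF that] loops[of "m - k x"]] by simp
      qed
      then show ?thesis by blast
    qed
    then obtain k where k: "\<And>x. x \<in> F \<Longrightarrow> z \<in> set_pmf (iterate_kernel K (k * L) (return_pmf x))"
      by blast
    define K' where "K' = (\<lambda>x. iterate_kernel K (k * L) (return_pmf x))"
    \<comment> \<open>The inserted 1 keeps \<open>Min\<close> meaningful and positive when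
      \<open>F\<close> is empty.\<close>
    define \<delta> where "\<delta> = Min (insert 1 ((\<lambda>x. pmf (K' x) z) ` F))"
    have "\<delta> > 0" using k F(1) by (auto simp: \<delta>_def K'_def pmf_positive_iff)
    have \<delta>: "\<delta> \<le> pmf (K' x) z" if "x \<in> F" for x
      using that F(1) by (simp add: \<delta>_def)
    have step: "Ov (j * L) + \<delta> * (\<eta> / 2) \<le> Ov ((j + k) * L)" for j
    proof -
      let ?p = "iterate_kernel K (j * L) p" and ?r = "iterate_kernel K (j * L) r"
      have r: "?r = r" using per by (rule iterate_kernel_periodic)
      have "measure_pmf.prob ?p (- F) \<le> (C + 1) * measure_pmf.prob r (- F)"
        using prob_dominated[of ?p C r "- F"] iterate_kernel_dominated[OF dom C, of K "j * L"] C
        by (simp add: r distrib_right add_increasing2)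
      moreover have "measure_pmf.prob r (- F) \<le> (C + 1) * measure_pmf.prob r (- F)"
        using C by (simp add: distrib_right)
      ultimately have "overlap ?p ?r + \<delta> * (1 - overlap ?p ?r - \<eta> / 2)
          \<le> overlap (bind_pmf ?p K') (bind_pmf ?r K')"
        using mass_F \<open>\<delta> > 0\<close> \<delta> F(1) by (intro overlap_bind_increase[of F]) (auto simp: r)
      then have "Ov (j * L) + \<delta> * (1 - Ov (j * L) - \<eta> / 2) \<le> Ov ((j + k) * L)"
        unfolding Ov_def K'_def by (simp add: add_mult_distrib iterate_kernel_add flip: iterate_kernel_bind)
      moreover have "\<delta> * (\<eta> / 2) \<le> \<delta> * (1 - Ov (j * L) - \<eta> / 2)"
        using \<open>\<delta> > 0\<close> le[of "j * L"] by (intro mult_left_mono) (auto simp: \<eta>_def field_simps)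
      ultimately show ?thesis by linarith
    qed
    have "(\<lambda>j. Ov (j * L)) \<longlonglongrightarrow> l"
      using LIMSEQ_subseq_LIMSEQ[OF lim, of "\<lambda>j. j * L"] L by (simp add: strict_mono_def o_def)
    moreover have "l > l - \<delta> * (\<eta> / 2)" using \<open>\<delta> > 0\<close> \<open>\<eta> > 0\<close> by simp
    ultimately have "\<forall>\<^sub>F j in sequentially. Ov (j * L) > l - \<delta> * (\<eta> / 2)"
      by (rule order_tendstoD)
    then obtain j where "Ov (j * L) > l - \<delta> * (\<eta> / 2)"
      by (auto simp: eventually_sequentially)
    then show False using step[of j] le[of "(j + k) * L"] by linarith
  qed
  have "(\<lambda>n. 1 - Ov n) \<longlonglongrightarrow> 0"
    using tendsto_diff[OF tendsto_const lim, of 1] by (simp add: \<open>l = 1\<close>)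
  then show ?thesis
    by (rule Lim_null_comparison[rotated]) (simp add: Ov_def abs_pmf_diff_le_overlap)
qed

section \<open>Energy and phases\<close>

text \<open>Forced by two requirements: exchanging a descent for an ascent lowers the energy by one, and
  the energy of a word is unchanged when its last letter, decreased by one, is moved to the front.\<close>

definition pair_energy :: "int \<Rightarrow> int \<Rightarrow> nat" where
  "pair_energy y z = nat (max (y - z) (z - y - 1))"

primrec energy :: "int list \<Rightarrow> nat" where
  "energy [] = 0"
| "energy (x # xs) = (\<Sum>y\<leftarrow>xs. pair_energy x y) + energy xs"

lemma energy_append:
  "energy (xs @ ys) = energy xs + energy ys + (\<Sum>x\<leftarrow>xs. \<Sum>y\<leftarrow>ys. pair_energy x y)"
  by (induction xs) auto

lemma energy_rotate: "energy ((d - 1) # b) = energy (b @ [d])"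
proof -
  have "pair_energy (d - 1) x = pair_energy x d" for x
    by (simp add: pair_energy_def max.commute algebra_simps)
  then show ?thesis by (simp add: energy_append)
qed

lemma energy_translate: "energy (map (\<lambda>x. x + c) xs) = energy xs"
  by (induction xs) (auto simp: pair_energy_def o_def)

text \<open>Reversal exchanges the two letters of a pair and negation flips the sign of their
  difference; the two effects cancel in \<open>pair_energy\<close>.\<close>

lemma energy_reverse_negate: "energy (rev (map uminus xs)) = energy xs"
proof (induction xs)
  case (Cons x xs)
  have "pair_energy (- y) (- x) = pair_energy x y" for y
    by (simp add: pair_energy_def)
  with Cons show ?case
    by (simp add: energy_append o_def rev_map[symmetric] sum_list_rev)
qed simp

lemma energy_swap_adjacent:
  "energy (xs @ y # z # ys) + pair_energy z y = energy (xs @ z # y # ys) + pair_energy y z"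
  by (simp add: energy_append algebra_simps sum_list_addf)

lemma energy_0_imp_near: "energy (b @ [d]) = 0 \<Longrightarrow> x \<in> set b \<Longrightarrow> x \<le> d \<and> d \<le> x + 1"
  by (fastforce simp: energy_append pair_energy_def)

text \<open>A pair has energy zero exactly when its second letter equals the first or exceeds it by
  one.\<close>

lemma energy_sorted_narrow:
  assumes "sorted xs" "\<And>x. x \<in> set xs \<Longrightarrow> c \<le> x \<and> x \<le> c + 1"
  shows "energy xs = 0"
  using assms
proof (induction xs)
  case (Cons x xs)
  have "pair_energy x y = 0" if "y \<in> set xs" for y
  proof -
    have "x \<le> y" "c \<le> x" "y \<le> c + 1" using Cons.prems that by auto
    then show ?thesis by (simp add: pair_energy_def)
  qed
  then have "(\<Sum>y\<leftarrow>xs. pair_energy x y) = 0" by simp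
  then show ?case using Cons by simp
qed simp

text \<open>Reads \<open>d\<close> as a letter inserted just before \<open>b\<^sub>t\<close>. In this order a swap at \<open>t \<le> M\<close> leaves the
  word unchanged, while keeping \<open>d\<close> exchanges the two adjacent letters \<open>d, b\<^sub>t\<close>.\<close>

definition arrangement :: "bdm_state \<Rightarrow> int list" where
  "arrangement s = (case s of (bs, d, T, t) \<Rightarrow> take (t - 1) bs @ d # drop (t - 1) bs)"

definition bdm_energy :: "bdm_state \<Rightarrow> nat" where
  "bdm_energy s = energy (arrangement s)"

text \<open>Shifted so that the initial state has clock 0.\<close>

definition clock :: "nat \<Rightarrow> bdm_state \<Rightarrow> int" where
  "clock M s = (case s of (bs, d, T, t) \<Rightarrow> T * (int M + 1) + int t - 1 - int M)"

text \<open>There are M + 1 values of \<open>T\<close>, each with M + 1 values of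
  \<open>t\<close>.\<close>

definition period :: "nat \<Rightarrow> nat" where
  "period M = (M + 1) ^ 2"

text \<open>The clock advances deterministically, so this set contains every state that the chain
  can occupy at time \<open>n\<close>.\<close>

definition phase_states :: "nat \<Rightarrow> nat \<Rightarrow> bdm_state set" where
  "phase_states M n = {s \<in> bdm_states M. [clock M s = int n] (mod int (period M))}"

lemma mem_bdm_states:
  "(bs, d, T, t) \<in> bdm_states M \<longleftrightarrow> length bs = M \<and> 1 \<le> t \<and> t \<le> M + 1 \<and>
      d + T + sum_list bs = 0 \<and> 0 \<le> T \<and> T \<le> int M"
  by (auto simp: bdm_states_def bdm_aug_states_def)

text \<open>After undoing the shift, \<open>T\<close> and \<open>t - 1\<close> are the two digits of
  the clock in base M + 1, and the clock lies between 0 and \<open>period M - 1\<close>.\<close>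

lemma clock_cong_imp_eq:
  assumes "(bs, d, T, t) \<in> bdm_states M" "(bs', d', T', t') \<in> bdm_states M"
    and "[clock M (bs, d, T, t) = clock M (bs', d', T', t')] (mod int (period M))"
  shows "T = T' \<and> t = t'"
proof -
  define m where "m = int M + 1"
  have m: "m > 0" "int (period M) = m * m" by (auto simp: m_def period_def power2_eq_square algebra_simps)
  have b: "0 \<le> T" "T \<le> m - 1" "0 \<le> T'" "T' \<le> m - 1" "0 \<le> int t - 1" "int t - 1 < m" "0 \<le> int t' - 1" "int t' - 1 < m"
    using assms(1,2) by (auto simp: mem_bdm_states m_def)
  have range: "0 \<le> a * m + c \<and> a * m + c < m * m" if "0 \<le> a" "a \<le> m - 1" "0 \<le> c" "c < m" for a c :: int
  proof -
    have "a * m \<le> (m - 1) * m" using that m by (intro mult_right_mono) auto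
    then show ?thesis using that m by (auto simp: algebra_simps)
  qed
  have "[T * m + (int t - 1) - int M = T' * m + (int t' - 1) - int M] (mod (m * m))"
    using assms(3) m by (simp add: clock_def m_def algebra_simps)
  then have "[T * m + (int t - 1) = T' * m + (int t' - 1)] (mod (m * m))"
    using cong_add[OF _ cong_refl[of "int M"]] by fastforce
  then have eq: "T * m + (int t - 1) = T' * m + (int t' - 1)"
    using range[of T "int t - 1"] range[of T' "int t' - 1"] b
    by (auto simp: cong_def)
  have "T = (T * m + (int t - 1)) div m" using b m by simp
  also have "\<dots> = T'" unfolding eq using b m by simp
  finally show ?thesis using eq by simp
qed

lemma set_pmf_bdm_step:
  assumes "q \<ge> 2"
  shows "set_pmf (bdm_step M q (bs, d, T, t)) =
    (if t \<le> M then
       (if bs ! (t - 1) > d then {(bs[t - 1 := d], bs ! (t - 1), T, t + 1), (bs, d, T, t + 1)}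
        else {(bs, d, T, t + 1)})
     else if T < int M then {(bs, d - 1, T + 1, 1)}
     else {(map (\<lambda>x. x + 1) bs, d, 0, 1)})"
proof -
  have "0 < (real q - 1) / real q" "(real q - 1) / real q < 1" using assms by auto
  then show ?thesis by (auto simp: bdm_step_def set_pmf_bernoulli)
qed

lemma sum_list_update_int:
  fixes xs :: "int list"
  shows "k < length xs \<Longrightarrow> sum_list (xs[k := x]) = sum_list xs + x - xs ! k"
  by (induction xs arbitrary: k) (auto split: nat.split)

lemma sum_list_map_add_const: "sum_list (map (\<lambda>x. x + c) xs) = sum_list xs + int (length xs) * c"
  by (induction xs) (auto simp: algebra_simps)

lemma bdm_step_in_states:
  assumes "q \<ge> 2" "s \<in> bdm_states M" "s' \<in> set_pmf (bdm_step M q s)"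
  shows "s' \<in> bdm_states M" "[clock M s' = clock M s + 1] (mod int (period M))"
proof -
  obtain bs d T t where s: "s = (bs, d, T, t)" by (cases s)
  have "t \<ge> 1" "length bs = M" using assms by (auto simp: s mem_bdm_states)
  then have "sum_list (bs[t - 1 := d]) = sum_list bs + d - bs ! (t - 1)" if "t \<le> M"
    using that \<open>t \<ge> 1\<close> \<open>length bs = M\<close> by (intro sum_list_update_int) auto
  then show "s' \<in> bdm_states M"
    using assms by (auto simp: s set_pmf_bdm_step mem_bdm_states sum_list_map_add_const split: if_splits)
  show "[clock M s' = clock M s + 1] (mod int (period M))"
  proof (cases "t \<le> M \<or> T < int M")
    case True
    then have "clock M s' = clock M s + 1"
      using assms by (auto simp: s set_pmf_bdm_step mem_bdm_states clock_def algebra_simps split: if_splits)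
    then show ?thesis by simp
  next
    case False
    \<comment> \<open>The wrap takes the clock from its largest value M (M + 1) to its smallest
      value -M.\<close>
    then have "clock M s' = clock M s + 1 - int (period M)"
      using assms by (auto simp: s set_pmf_bdm_step mem_bdm_states clock_def algebra_simps period_def power2_eq_square split: if_splits)
    then show ?thesis by (simp add: cong_iff_dvd_diff)
  qed
qed

lemma step_in_phase:
  assumes "q \<ge> 2" "s \<in> phase_states M n" "s' \<in> set_pmf (bdm_step M q s)"
  shows "s' \<in> phase_states M (Suc n)"
proof -
  have "[clock M s = int n] (mod int (period M))" "s \<in> bdm_states M"
    using assms(2) by (auto simp: phase_states_def)
  then have "[clock M s + 1 = int n + 1] (mod int (period M))" by (intro cong_add) auto
  then have "[clock M s' = int n + 1] (mod int (period M))"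
    using bdm_step_in_states(2)[OF assms(1) \<open>s \<in> bdm_states M\<close> assms(3)] cong_trans by blast
  then show ?thesis
    using bdm_step_in_states(1)[OF assms(1) \<open>s \<in> bdm_states M\<close> assms(3)]
    by (simp add: phase_states_def add.commute)
qed

section \<open>Stationarity\<close>

lemma pmf_map_bernoulli_if:
  assumes "a \<noteq> b" "0 \<le> p" "p \<le> 1"
  shows "pmf (map_pmf (\<lambda>c. if c then a else b) (bernoulli_pmf p)) x
    = (if x = a then p else if x = b then 1 - p else 0)"
proof -
  have "(\<lambda>c. if c then a else b) -` {x} = (if x = a then {True} else if x = b then {False} else {})"
    using assms(1) by (auto split: if_splits)
  then show ?thesis using assms by (simp add: pmf_map measure_pmf_single)
qed

lemma pmf_bdm_step:
  assumes "q \<ge> 2"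
  shows "pmf (bdm_step M q (bs, d, T, t)) s =
    (if t \<le> M then
       (if bs ! (t - 1) > d then
          (if s = (bs[t - 1 := d], bs ! (t - 1), T, t + 1) then 1 - 1 / real q
           else if s = (bs, d, T, t + 1) then 1 / real q else 0)
        else of_bool (s = (bs, d, T, t + 1)))
     else if T < int M then of_bool (s = (bs, d - 1, T + 1, 1))
     else of_bool (s = (map (\<lambda>x. x + 1) bs, d, 0, 1)))"
proof -
  have "(real q - 1) / real q = 1 - 1 / real q" using assms by (simp add: field_simps)
  then show ?thesis
    using assms by (auto simp: bdm_step_def pmf_map_bernoulli_if indicator_def)
qed

lemma arrangement_Suc:
  assumes "k < length bs"
  shows "arrangement (bs, d, T, Suc k) = take k bs @ d # bs ! k # drop (Suc k) bs"
    and "arrangement (bs, d, T, Suc (Suc k)) = take k bs @ bs ! k # d # drop (Suc k) bs"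
    and "arrangement (bs[k := d], bs ! k, T, Suc k) = take k bs @ bs ! k # d # drop (Suc k) bs"
    and "arrangement (bs[k := d], bs ! k, T, Suc (Suc k)) = take k bs @ d # bs ! k # drop (Suc k) bs"
  using assms
  by (simp_all add: arrangement_def Cons_nth_drop_Suc take_Suc_conv_app_nth drop_update_cancel flip: Cons_nth_drop_Suc)

lemma energy_exchange:
  assumes "d < y"
  shows "energy (xs @ y # d # ys) = Suc (energy (xs @ d # y # ys))"
  using energy_swap_adjacent[of xs y d ys] assms by (simp add: pair_energy_def)

lemma bdm_energy_wrap:
  "bdm_energy (bs, d - 1, T', 1) = bdm_energy (bs, d, T, Suc (length bs))"
  "bdm_energy (map (\<lambda>x. x + 1) bs, d, T', 1) = bdm_energy (bs, d, T, Suc (length bs))"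
  using energy_translate[of 1 "(d - 1) # bs"]
  by (simp_all add: bdm_energy_def arrangement_def energy_rotate del: energy.simps)

definition weight :: "nat \<Rightarrow> bdm_state \<Rightarrow> real" where
  "weight q s = (1 / real q) ^ bdm_energy s"

definition predecessors :: "nat \<Rightarrow> nat \<Rightarrow> bdm_state \<Rightarrow> bdm_state set" where
  "predecessors M q s' = {s \<in> bdm_states M. s' \<in> set_pmf (bdm_step M q s)}"

text \<open>Few states can lead to \<open>s'\<close>: for \<open>t > 1\<close> one that kept its
  letters and one that swapped them, for \<open>t = 1\<close> the inverse of an energy preserving
  wrap. Balance is then a comparison of energies.\<close>

lemma weight_stationary:
  assumes q: "q \<ge> 2" and s': "s' \<in> bdm_states M"
  shows "finite (predecessors M q s')"
    and "(\<Sum>s\<in>predecessors M q s'. weight q s * pmf (bdm_step M q s) s') = weight q s'"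
proof -
  let ?P = "predecessors M q s'"
  \<comment> \<open>Any finite set of states that contains the predecessors will do, since the
    others have transition probability zero.\<close>
  have *: "finite ?P \<and> (\<Sum>s\<in>?P. weight q s * pmf (bdm_step M q s) s') = weight q s'"
    if A: "?P \<subseteq> A" "finite A" "A \<subseteq> bdm_states M"
      and sum: "(\<Sum>s\<in>A. weight q s * pmf (bdm_step M q s) s') = weight q s'" for A
  proof -
    have "(\<Sum>s\<in>?P. weight q s * pmf (bdm_step M q s) s') = (\<Sum>s\<in>A. weight q s * pmf (bdm_step M q s) s')"
      using A by (intro sum.mono_neutral_left) (auto simp: predecessors_def set_pmf_iff)
    then show ?thesis using A sum finite_subset by auto
  qed
  obtain bs d T t where s: "s' = (bs, d, T, t)" by (cases s')
  have len: "length bs = M" using s' by (simp add: s mem_bdm_states)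
  consider k where "t = Suc (Suc k)" "k < M" | "t = 1" "T > 0" | "t = 1" "T = 0"
  proof -
    have "1 \<le> t" "t \<le> M + 1" "0 \<le> T" using s' by (auto simp: s mem_bdm_states)
    moreover have "\<exists>k. t = Suc (Suc k) \<and> k < M" if "t \<noteq> 1"
      using that \<open>1 \<le> t\<close> \<open>t \<le> M + 1\<close> by (intro exI[of _ "t - 2"]) auto
    ultimately show ?thesis using that by fastforce
  qed
  then have "finite ?P \<and> (\<Sum>s\<in>?P. weight q s * pmf (bdm_step M q s) s') = weight q s'"
  proof cases
    case 1
    let ?y = "bs ! k"
    let ?s1 = "(bs, d, T, Suc k)" and ?s2 = "(bs[k := d], ?y, T, Suc k)"
    show ?thesis
    proof (rule *[of "{?s1, ?s2}"])
      show "?P \<subseteq> {?s1, ?s2}"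
      proof
        fix x assume "x \<in> ?P"
        moreover obtain bs0 d0 T0 t0 where x: "x = (bs0, d0, T0, t0)" by (cases x)
        ultimately have "x \<in> bdm_states M" "s' \<in> set_pmf (bdm_step M q (bs0, d0, T0, t0))"
          by (auto simp: predecessors_def)
        then show "x \<in> {?s1, ?s2}"
          using 1 q by (auto simp: x s set_pmf_bdm_step mem_bdm_states split: if_splits)
      qed
      show "{?s1, ?s2} \<subseteq> bdm_states M"
        using s' 1 by (auto simp: s mem_bdm_states sum_list_update_int)
      have e': "bdm_energy s' = energy (take k bs @ ?y # d # drop (Suc k) bs)"
        and e1: "bdm_energy ?s1 = energy (take k bs @ d # ?y # drop (Suc k) bs)"
        and e2: "bdm_energy ?s2 = bdm_energy s'"
        using 1 len by (simp_all add: s bdm_energy_def arrangement_Suc)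
      have ne: "bs[k := d] \<noteq> bs" if "d \<noteq> ?y"
        using that 1 len by (metis nth_list_update_eq)
      have sum2: "(\<Sum>s\<in>{?s1, ?s2}. weight q s * pmf (bdm_step M q s) s')
          = weight q ?s1 * pmf (bdm_step M q ?s1) s' + weight q ?s2 * pmf (bdm_step M q ?s2) s'" if "d \<noteq> ?y"
        using that ne by (subst sum.insert) auto
      consider "d < ?y" | "?y < d" | "d = ?y" by linarith
      then show "(\<Sum>s\<in>{?s1, ?s2}. weight q s * pmf (bdm_step M q s) s') = weight q s'"
      proof cases
        \<comment> \<open>Only the keeping state leads here, with probability 1/q and from one
          energy level below. The swapped one has its letters in the order that forbids a
          swap.\<close>
        assume lt: "d < ?y"
        then have "bdm_energy s' = Suc (bdm_energy ?s1)" by (simp add: e' e1 energy_exchange)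
        then show ?thesis
          using lt sum2 1 len q ne by (simp add: pmf_bdm_step weight_def s)
      next
        \<comment> \<open>Keeping is forced and starts one energy level above, which contributes the
          fraction 1/q; the swap starts on the same level and contributes 1 - 1/q.\<close>
        assume gt: "?y < d"
        then have "bdm_energy ?s1 = Suc (bdm_energy s')" by (simp add: e' e1 energy_exchange)
        then show ?thesis
          using gt sum2 1 len q ne e2 by (simp add: pmf_bdm_step weight_def s field_simps)
      next
        assume eq: "d = ?y"
        then have "?s2 = ?s1" by simp
        moreover have "bdm_energy s' = bdm_energy ?s1" by (simp only: e' e1 flip: eq)
        ultimately show ?thesis
          using eq 1 len q by (simp add: pmf_bdm_step weight_def s)
      qed
    qed simp
  next
    case 2
    let ?s1 = "(bs, d + 1, T - 1, Suc M)"
    show ?thesis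
    proof (rule *[of "{?s1}"])
      show "?P \<subseteq> {?s1}"
        using 2 q by (auto simp: predecessors_def s set_pmf_bdm_step mem_bdm_states split: if_splits)
      show "{?s1} \<subseteq> bdm_states M" using s' 2 by (auto simp: s mem_bdm_states)
      have "bdm_energy ?s1 = bdm_energy s'"
        using 2 bdm_energy_wrap(1)[of bs "d + 1" T] len by (simp add: s)
      moreover have "T - 1 < int M" using s' by (simp add: s mem_bdm_states)
      ultimately show "(\<Sum>s\<in>{?s1}. weight q s * pmf (bdm_step M q s) s') = weight q s'"
        using 2 q by (simp add: pmf_bdm_step weight_def s)
    qed simp
  next
    case 3
    let ?bs = "map (\<lambda>x. x - 1) bs"
    let ?s1 = "(?bs, d, int M, Suc M)"
    have bs: "map (\<lambda>x. x + 1) ?bs = bs" by (simp add: o_def)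
    show ?thesis
    proof (rule *[of "{?s1}"])
      show "?P \<subseteq> {?s1}"
        using 3 q by (auto simp: predecessors_def s set_pmf_bdm_step mem_bdm_states o_def split: if_splits)
      show "{?s1} \<subseteq> bdm_states M"
        using s' 3 sum_list_map_add_const[of "-1" bs] by (auto simp: s mem_bdm_states)
      have "bdm_energy ?s1 = bdm_energy s'"
        using 3 bdm_energy_wrap(2)[of ?bs d T] len by (simp add: s bs del: map_map)
      then show "(\<Sum>s\<in>{?s1}. weight q s * pmf (bdm_step M q s) s') = weight q s'"
        using 3 q by (simp add: pmf_bdm_step weight_def s bs del: map_map)
    qed simp
  qed
  then show "finite ?P" "(\<Sum>s\<in>?P. weight q s * pmf (bdm_step M q s) s') = weight q s'"
    by auto
qed

lemma predecessors_phase: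
  assumes "q \<ge> 2" "s' \<in> phase_states M (Suc n)" "s \<in> predecessors M q s'"
  shows "s \<in> phase_states M n"
proof -
  have s: "s \<in> bdm_states M" "s' \<in> set_pmf (bdm_step M q s)"
    using assms(3) by (auto simp: predecessors_def)
  have "[clock M s + 1 = int n + 1] (mod int (period M))"
    using bdm_step_in_states(2)[OF assms(1) s] assms(2)
    by (auto simp: phase_states_def add.commute intro: cong_trans cong_sym)
  then show ?thesis using s by (simp add: phase_states_def cong_add_rcancel)
qed

text \<open>All predecessors of a state of phase n + 1 lie in phase n, so balance on the whole state
  set splits into one equation from each phase to the next, with the same \<open>c\<close>.\<close>

lemma bind_phase_distribution:
  assumes q: "q \<ge> 2" and p: "\<And>s. pmf p s = (if s \<in> phase_states M n then c * weight q s else 0)"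
  shows "pmf (bind_pmf p (bdm_step M q)) s'
    = (if s' \<in> phase_states M (Suc n) then c * weight q s' else 0)"
proof -
  have supp: "s \<in> phase_states M n" if "s \<in> set_pmf p" for s
    using that by (auto simp: set_pmf_iff p split: if_splits)
  show ?thesis
  proof (cases "s' \<in> phase_states M (Suc n)")
    case False
    then have "s' \<notin> set_pmf (bind_pmf p (bdm_step M q))"
      using supp step_in_phase[OF q] by (simp only: set_bind_pmf) blast
    then show ?thesis using False by (simp add: pmf_eq_0_set_pmf)
  next
    case True
    then have s': "s' \<in> bdm_states M" by (simp add: phase_states_def)
    have "pmf (bind_pmf p (bdm_step M q)) s'
        = (\<Sum>s\<in>predecessors M q s'. pmf p s * pmf (bdm_step M q s) s')"
      unfolding pmf_bind using supp
      by (subst integral_measure_pmf_real[OF weight_stationary(1)[OF q s']])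
         (auto simp: predecessors_def phase_states_def set_pmf_iff mult.commute)
    also have "\<dots> = (\<Sum>s\<in>predecessors M q s'. c * (weight q s * pmf (bdm_step M q s) s'))"
      using predecessors_phase[OF q True] by (intro sum.cong) (auto simp: p)
    also have "\<dots> = c * weight q s'"
      by (simp add: weight_stationary(2)[OF q s'] flip: sum_distrib_left)
    finally show ?thesis using True by simp
  qed
qed

section \<open>Reachability of the initial state\<close>

text \<open>The states of least energy among those reachable from a given state form such a set. On it no
  comparison can lower the energy, which forces sorted arrangements of spread at most one.\<close>

definition energy_plateau :: "nat \<Rightarrow> nat \<Rightarrow> nat \<Rightarrow> bdm_state set \<Rightarrow> bool" where
  "energy_plateau M q e Q \<longleftrightarrow> (\<forall>s\<in>Q. s \<in> bdm_states M \<and> bdm_energy s = e \<and>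
     (\<forall>s'\<in>set_pmf (bdm_step M q s). e \<le> bdm_energy s' \<and> (bdm_energy s' = e \<longrightarrow> s' \<in> Q)))"

lemma plateau_mem:
  assumes "energy_plateau M q e Q" "s \<in> Q"
  shows "s \<in> bdm_states M" "bdm_energy s = e"
  using assms unfolding energy_plateau_def by blast+

text \<open>If the letter after \<open>d\<close> were smaller, \<open>d\<close> would be kept, and
  the word would lose an inversion and drop below the energy \<open>e\<close>. Otherwise the swap is
  possible (for equal letters it coincides with keeping) and leaves the word as it is.\<close>

lemma plateau_compare:
  assumes q: "q \<ge> 2" and Q: "energy_plateau M q e Q"
    and s: "(bs, d, T, Suc k) \<in> Q" and k: "k < M"
  shows "d \<le> bs ! k"
    and "(bs[k := d], bs ! k, T, Suc (Suc k)) \<in> Q"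
    and "(bs[k := d], bs ! k, T, Suc (Suc k)) \<in> set_pmf (bdm_step M q (bs, d, T, Suc k))"
    and "arrangement (bs[k := d], bs ! k, T, Suc (Suc k)) = arrangement (bs, d, T, Suc k)"
proof -
  let ?s = "(bs, d, T, Suc k)" and ?s' = "(bs[k := d], bs ! k, T, Suc (Suc k))"
  have len: "k < length bs" and e: "bdm_energy ?s = e"
    using plateau_mem[OF Q s] k by (auto simp: mem_bdm_states)
  show d: "d \<le> bs ! k"
  proof (rule ccontr)
    assume lt: "\<not> d \<le> bs ! k"
    then have "(bs, d, T, Suc (Suc k)) \<in> set_pmf (bdm_step M q ?s)"
      using k q by (simp add: set_pmf_bdm_step)
    then have "e \<le> bdm_energy (bs, d, T, Suc (Suc k))"
      using Q s unfolding energy_plateau_def by blast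
    then show False
      using e energy_exchange[of "bs ! k" d "take k bs" "drop (Suc k) bs"] lt len
      by (simp add: bdm_energy_def arrangement_Suc)
  qed
  show step: "?s' \<in> set_pmf (bdm_step M q ?s)"
  proof (cases "d = bs ! k")
    case True
    then have "bs[k := d] = bs" by simp
    then show ?thesis using k q True by (simp add: set_pmf_bdm_step)
  next
    case False
    then show ?thesis using k q d by (simp add: set_pmf_bdm_step)
  qed
  show arr: "arrangement ?s' = arrangement ?s" using len by (simp add: arrangement_Suc)
  show "?s' \<in> Q" using step arr Q s e unfolding energy_plateau_def bdm_energy_def by metis
qed

lemma plateau_wrap:
  assumes q: "q \<ge> 2" and Q: "energy_plateau M q e Q" and s: "(bs, d, T, Suc M) \<in> Q"
  obtains T' bs' d' where "(bs', d', T', 1) \<in> Q"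
    "(bs', d', T', 1) \<in> set_pmf (bdm_step M q (bs, d, T, Suc M))"
    "bs' = bs \<and> d' = d - 1 \<or> bs' = map (\<lambda>x. x + 1) bs \<and> d' = d"
proof -
  have len: "length bs = M" and e: "bdm_energy (bs, d, T, Suc M) = e"
    using plateau_mem[OF Q s] by (auto simp: mem_bdm_states)
  have Q': "s' \<in> Q" if "s' \<in> set_pmf (bdm_step M q (bs, d, T, Suc M))" "bdm_energy s' = e" for s'
    using that Q[unfolded energy_plateau_def, rule_format, OF s] by simp
  show thesis
  proof (cases "T < int M")
    case True
    then have *: "(bs, d - 1, T + 1, 1) \<in> set_pmf (bdm_step M q (bs, d, T, Suc M))"
      using q by (simp add: set_pmf_bdm_step)
    show thesis
      by (rule that[OF Q'[OF *] *]) (use e len bdm_energy_wrap(1)[of bs d _ T] in auto)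
  next
    case False
    then have *: "(map (\<lambda>x. x + 1) bs, d, 0, 1) \<in> set_pmf (bdm_step M q (bs, d, T, Suc M))"
      using q by (simp add: set_pmf_bdm_step)
    show thesis
      by (rule that[OF Q'[OF *] *]) (use e len bdm_energy_wrap(2)[of bs d _ T] in auto)
  qed
qed

lemma sorted_take_Suc:
  assumes "sorted (take (Suc k) xs)" "xs ! k \<le> xs ! Suc k" "Suc k < length xs"
  shows "sorted (take (Suc (Suc k)) xs)"
  using assms by (auto simp: sorted_iff_nth_Suc less_Suc_eq)

text \<open>Swapping at every step moves the insertion point along the fixed word
  \<open>d # bs\<close>, and each comparison on the way certifies one more adjacent pair as
  ascending.\<close>

lemma plateau_round:
  assumes q: "q \<ge> 2" and Q: "energy_plateau M q e Q" and s: "(bs, d, T, 1) \<in> Q" and "k \<le> M"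
  shows "(\<exists>bs' d'. (bs', d', T, Suc k) \<in> Q \<and> arrangement (bs', d', T, Suc k) = d # bs)
    \<and> sorted (take (Suc k) (d # bs))"
  using \<open>k \<le> M\<close>
proof (induction k)
  case 0
  then show ?case using s by (auto simp: arrangement_def)
next
  case (Suc k)
  then obtain bs' d' where s': "(bs', d', T, Suc k) \<in> Q" "arrangement (bs', d', T, Suc k) = d # bs"
    and sorted: "sorted (take (Suc k) (d # bs))" by auto
  have k: "k < M" using Suc.prems by simp
  then have len: "k < length bs'" "k < length bs"
    using plateau_mem(1)[OF Q s] plateau_mem(1)[OF Q s'(1)] by (auto simp: mem_bdm_states)
  note cmp = plateau_compare[OF q Q s'(1) k]
  have arr: "d # bs = take k bs' @ d' # bs' ! k # drop (Suc k) bs'"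
    using s'(2) len by (simp add: arrangement_Suc)
  have "(d # bs) ! k = d'" "(d # bs) ! Suc k = bs' ! k"
    unfolding arr using len by (simp_all add: nth_append)
  then have "(d # bs) ! k \<le> (d # bs) ! Suc k" using cmp(1) by simp
  then have "sorted (take (Suc (Suc k)) (d # bs))"
    using sorted len by (intro sorted_take_Suc) auto
  then show ?case using cmp s'(2) by metis
qed

lemma plateau_sorted:
  assumes "q \<ge> 2" "energy_plateau M q e Q" "(bs, d, T, 1) \<in> Q"
  shows "sorted (d # bs)" "\<exists>bs' d'. (bs', d', T, Suc M) \<in> Q \<and> bs' @ [d'] = d # bs"
proof -
  have len: "length bs = M" using plateau_mem(1)[OF assms(2,3)] by (simp add: mem_bdm_states)
  show "sorted (d # bs)" using plateau_round[OF assms, of M] len by simp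
  obtain bs' d' where *: "(bs', d', T, Suc M) \<in> Q" "arrangement (bs', d', T, Suc M) = d # bs"
    using plateau_round[OF assms, of M] by auto
  then have "length bs' = M" using plateau_mem(1)[OF assms(2)] by (fastforce simp: mem_bdm_states)
  then show "\<exists>bs' d'. (bs', d', T, Suc M) \<in> Q \<and> bs' @ [d'] = d # bs"
    using * by (auto simp: arrangement_def)
qed

text \<open>The word after a round is sorted, so its last letter \<open>d'\<close> is the largest.
  The wrap puts this letter in front, lowered by one relative to the others, and the next round
  shows that the new word is sorted too. Hence no letter lies below \<open>d' - 1\<close>.\<close>

lemma plateau_energy_0:
  assumes q: "q \<ge> 2" and M: "M \<ge> 1" and Q: "energy_plateau M q e Q" and s: "(bs, d, T, 1) \<in> Q"
  shows "e = 0"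
proof -
  obtain bs' d' where s': "(bs', d', T, Suc M) \<in> Q" and arr: "bs' @ [d'] = d # bs"
    using plateau_sorted[OF q Q s] by auto
  obtain T'' bs'' d'' where s'': "(bs'', d'', T'', 1) \<in> Q"
    and cases: "bs'' = bs' \<and> d'' = d' - 1 \<or> bs'' = map (\<lambda>x. x + 1) bs' \<and> d'' = d'"
    using plateau_wrap[OF q Q s'] by metis
  have low: "d' - 1 \<le> x" if "x \<in> set bs'" for x
    using plateau_sorted(1)[OF q Q s''] cases that by force
  have sorted: "sorted (bs' @ [d'])" using plateau_sorted(1)[OF q Q s] arr by simp
  have "energy (bs' @ [d']) = 0"
    using sorted low by (intro energy_sorted_narrow[where c = "d' - 1"]) (auto simp: sorted_append)
  moreover have "bdm_energy (bs', d', T, Suc M) = energy (bs' @ [d'])"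
    using plateau_mem(1)[OF Q s'] by (simp add: mem_bdm_states bdm_energy_def arrangement_def)
  ultimately show "e = 0" using plateau_mem(2)[OF Q s'] by simp
qed

lemma plateau_successor:
  assumes q: "q \<ge> 2" and Q: "energy_plateau M q e Q" and s: "s \<in> Q"
  shows "\<exists>s'\<in>Q. s' \<in> set_pmf (bdm_step M q s)"
proof -
  obtain bs d T t where st: "s = (bs, d, T, t)" by (cases s)
  have t: "1 \<le> t" "t \<le> Suc M" using plateau_mem(1)[OF Q s] by (auto simp: st mem_bdm_states)
  consider k where "t = Suc k" "k < M" | "t = Suc M"
  proof (cases "t = Suc M")
    case False
    then have "t = Suc (t - 1)" "t - 1 < M" using t by auto
    then show ?thesis using that(1) by blast
  qed (use that(2) in blast)
  then show ?thesis
  proof cases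
    case 1
    then show ?thesis using plateau_compare[OF q Q, of bs d T k] s st by metis
  next
    case 2
    then show ?thesis using plateau_wrap[OF q Q, of bs d T] s st by metis
  qed
qed

lemma plateau_iterate:
  assumes q: "q \<ge> 2" and Q: "energy_plateau M q e Q" and s: "s \<in> Q"
  shows "\<exists>s'\<in>Q. s' \<in> set_pmf (iterate_kernel (bdm_step M q) n (return_pmf s))
    \<and> [clock M s' = clock M s + int n] (mod int (period M))"
proof (induction n)
  case (Suc n)
  then obtain s' where s': "s' \<in> Q" "s' \<in> set_pmf (iterate_kernel (bdm_step M q) n (return_pmf s))"
    "[clock M s' = clock M s + int n] (mod int (period M))" by auto
  obtain s'' where s'': "s'' \<in> Q" "s'' \<in> set_pmf (bdm_step M q s')"
    using plateau_successor[OF q Q s'(1)] by auto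
  have "s' \<in> bdm_states M" using plateau_mem(1)[OF Q s'(1)] .
  then have "[clock M s'' = clock M s' + 1] (mod int (period M))"
    using bdm_step_in_states(2)[OF q] s''(2) by blast
  moreover have "[clock M s' + 1 = clock M s + int n + 1] (mod int (period M))"
    using s'(3) by (intro cong_add) auto
  ultimately have "[clock M s'' = clock M s + int (Suc n)] (mod int (period M))"
    using cong_trans by (fastforce simp: algebra_simps)
  then show ?case using s' s'' by auto
qed (use s in auto)

section \<open>Zero energy and the return to the initial state\<close>

lemma bdm_init_in_states: "bdm_init M \<in> bdm_states M" "clock M (bdm_init M) = 0" "bdm_energy (bdm_init M) = 0"
proof -
  show "bdm_init M \<in> bdm_states M" "clock M (bdm_init M) = 0"
    by (simp_all add: bdm_init_def mem_bdm_states clock_def sum_list_replicate)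
  have "energy (replicate M 0 @ [0]) = 0"
    by (intro energy_sorted_narrow[where c = 0]) (auto simp: sorted_append)
  then show "bdm_energy (bdm_init M) = 0"
    by (simp add: bdm_init_def bdm_energy_def arrangement_def)
qed

lemma sum_list_bounds_const:
  fixes xs :: "int list"
  assumes "\<And>x. x \<in> set xs \<Longrightarrow> a \<le> x \<and> x \<le> b"
  shows "int (length xs) * a \<le> sum_list xs \<and> sum_list xs \<le> int (length xs) * b"
  using assms
proof (induction xs)
  case (Cons x xs)
  have "a \<le> x \<and> x \<le> b" using Cons.prems[of x] by simp
  moreover have "int (length xs) * a \<le> sum_list xs \<and> sum_list xs \<le> int (length xs) * b"
    using Cons.IH Cons.prems by simp
  ultimately show ?case by (simp add: distrib_right)
qed simp

lemma sum_list_nonpos_eq_0: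
  fixes xs :: "int list"
  assumes "\<And>x. x \<in> set xs \<Longrightarrow> x \<le> 0" "sum_list xs = 0"
  shows "xs = replicate (length xs) 0"
  using assms
proof (induction xs)
  case (Cons x xs)
  have "sum_list xs \<le> 0" using sum_list_nonpos[of xs] Cons.prems by auto
  moreover have "x \<le> 0" using Cons.prems(1)[of x] by simp
  ultimately have "x = 0" "sum_list xs = 0" using Cons.prems(2) by auto
  then show ?case using Cons by simp
qed simp

text \<open>The clock gives T = 0 and t = M + 1. Zero energy leaves only the values d - 1 and d for
  the letters, and the sum condition then gives 0 <= (M + 1) d <= M, so d = 0; nonpositive letters
  with sum zero all vanish.\<close>

lemma energy_0_imp_init:
  assumes s: "s \<in> bdm_states M" and e: "bdm_energy s = 0"
    and clock: "[clock M s = 0] (mod int (period M))"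
  shows "s = bdm_init M"
proof -
  obtain bs d T t where st: "s = (bs, d, T, t)" by (cases s)
  have Tt: "T = 0" "t = M + 1"
    using clock_cong_imp_eq[of bs d T t M "replicate M 0" 0 0 "M + 1"] s clock bdm_init_in_states[of M]
    by (simp_all add: st bdm_init_def)
  then have len: "length bs = M" and sum: "d + sum_list bs = 0"
    using s by (auto simp: st mem_bdm_states)
  have near: "x \<le> d \<and> d \<le> x + 1" if "x \<in> set bs" for x
    using energy_0_imp_near[of bs d x] that e len by (simp add: st Tt bdm_energy_def arrangement_def)
  have "int M * (d - 1) \<le> sum_list bs \<and> sum_list bs \<le> int M * d"
    using sum_list_bounds_const[of bs "d - 1" d] near len by force
  then have "(int M + 1) * d \<le> int M" "0 \<le> (int M + 1) * d"
    using sum by (auto simp: algebra_simps)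
  have "\<not> d \<ge> 1"
  proof
    assume "d \<ge> 1"
    then have "(int M + 1) * 1 \<le> (int M + 1) * d" by (intro mult_left_mono) auto
    then have "(int M + 1) * 1 \<le> int M" using \<open>(int M + 1) * d \<le> int M\<close> by (rule order_trans)
    then show False by simp
  qed
  moreover have "0 \<le> d"
    using \<open>0 \<le> (int M + 1) * d\<close> by (auto simp: zero_le_mult_iff)
  ultimately have "d = 0" by simp
  then have "bs = replicate M 0"
    using sum_list_nonpos_eq_0[of bs] near sum len by auto
  then show ?thesis by (simp add: st Tt \<open>d = 0\<close> bdm_init_def)
qed

lemma plateau_reaches_init:
  assumes q: "q \<ge> 2" and M: "M \<ge> 1" and Q: "energy_plateau M q e Q" and s: "s \<in> Q"
    and n: "[clock M s + int n = 0] (mod int (period M))"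
  shows "bdm_init M \<in> set_pmf (iterate_kernel (bdm_step M q) n (return_pmf s))"
proof -
  let ?L = "int (period M)"
  have "e = 0"
  proof -
    have L: "?L > 0" by (simp add: period_def)
    \<comment> \<open>After \<open>m\<close> steps the clock is congruent to -M, which means T = 0
      and t = 1, the start of a round.\<close>
    define m where "m = nat ((- int M - clock M s) mod ?L)"
    have "[clock M s + int m = - int M] (mod ?L)"
      using L by (simp add: m_def cong_def mod_simps)
    moreover obtain s' where s'_Q: "s' \<in> Q" and "[clock M s' = clock M s + int m] (mod ?L)"
      using plateau_iterate[OF q Q s, of m] by auto
    ultimately have s': "s' \<in> Q" "[clock M s' = - int M] (mod ?L)"
      using cong_trans by auto
    obtain bs d T t where st: "s' = (bs, d, T, t)" by (cases s')
    have "(bs, d, T, t) \<in> bdm_states M" using plateau_mem(1)[OF Q s'(1)] by (simp add: st)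
    moreover have "(replicate M 0, 0, 0, 1) \<in> bdm_states M" by (simp add: mem_bdm_states sum_list_replicate)
    moreover have "[clock M (bs, d, T, t) = clock M (replicate M 0, 0, 0, 1)] (mod ?L)"
      using s'(2) by (simp add: st clock_def)
    ultimately have "t = 1" using clock_cong_imp_eq by blast
    then show ?thesis using plateau_energy_0[OF q M Q] s' st by auto
  qed
  obtain s' where s': "s' \<in> Q" "s' \<in> set_pmf (iterate_kernel (bdm_step M q) n (return_pmf s))"
    and "[clock M s' = clock M s + int n] (mod ?L)"
    using plateau_iterate[OF q Q s, of n] by auto
  moreover from this n have "[clock M s' = 0] (mod ?L)" using cong_trans by blast
  ultimately have "s' = bdm_init M"
    using plateau_mem[OF Q, of s'] \<open>e = 0\<close> by (intro energy_0_imp_init) auto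
  then show ?thesis using s' by simp
qed

lemma iterate_kernel_in_phase:
  assumes "q \<ge> 2" "s \<in> phase_states M m" "s' \<in> set_pmf (iterate_kernel (bdm_step M q) n (return_pmf s))"
  shows "s' \<in> phase_states M (m + n)"
  using assms(3)
proof (induction n arbitrary: s')
  case (Suc n)
  from Suc.prems obtain x where "x \<in> set_pmf (iterate_kernel (bdm_step M q) n (return_pmf s))" "s' \<in> set_pmf (bdm_step M q x)"
    by (metis set_iterate_kernel_Suc)
  then have "s' \<in> phase_states M (Suc (m + n))"
    using step_in_phase[OF assms(1) Suc.IH[of x]] by blast
  then show ?case by simp
qed (use assms(2) in simp)

definition lowest_reachable :: "nat \<Rightarrow> nat \<Rightarrow> bdm_state \<Rightarrow> nat \<Rightarrow> bdm_state set" where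
  "lowest_reachable M q s e = {s'. (\<exists>n. s' \<in> set_pmf (iterate_kernel (bdm_step M q) n (return_pmf s))) \<and> bdm_energy s' = e}"

lemma lowest_reachable_plateau:
  assumes q: "q \<ge> 2" and s: "s \<in> bdm_states M"
    and min: "\<And>e'. lowest_reachable M q s e' \<noteq> {} \<Longrightarrow> e \<le> e'"
  shows "energy_plateau M q e (lowest_reachable M q s e)"
  unfolding energy_plateau_def
proof (intro ballI conjI impI)
  have ph: "s \<in> phase_states M (nat (clock M s mod int (period M)))"
    using s by (simp add: phase_states_def period_def)
  fix x assume x: "x \<in> lowest_reachable M q s e"
  then obtain n where n: "x \<in> set_pmf (iterate_kernel (bdm_step M q) n (return_pmf s))" "bdm_energy x = e"
    by (auto simp: lowest_reachable_def)
  show "x \<in> bdm_states M" using iterate_kernel_in_phase[OF q ph n(1)] by (simp add: phase_states_def)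
  show "bdm_energy x = e" by fact
  fix y assume "y \<in> set_pmf (bdm_step M q x)"
  then have "y \<in> set_pmf (iterate_kernel (bdm_step M q) (Suc n) (return_pmf s))"
    using n(1) by (metis set_iterate_kernel_Suc)
  then have y: "y \<in> lowest_reachable M q s (bdm_energy y)"
    unfolding lowest_reachable_def by blast
  then show "e \<le> bdm_energy y" using min by blast
  show "y \<in> lowest_reachable M q s e" if "bdm_energy y = e" using y that by simp
qed

text \<open>Zero is the least possible energy, so the states of energy zero reachable from the
  initial state form a plateau.\<close>

lemma init_returns:
  assumes "q \<ge> 2" "M \<ge> 1"
  shows "bdm_init M \<in> set_pmf (iterate_kernel (bdm_step M q) (period M) (return_pmf (bdm_init M)))"
proof (rule plateau_reaches_init[OF assms])
  show "energy_plateau M q 0 (lowest_reachable M q (bdm_init M) 0)"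
    by (rule lowest_reachable_plateau[OF assms(1)]) (auto simp: bdm_init_in_states)
  show "bdm_init M \<in> lowest_reachable M q (bdm_init M) 0"
    unfolding lowest_reachable_def by (auto simp: bdm_init_in_states intro: exI[of _ 0])
  show "[clock M (bdm_init M) + int (period M) = 0] (mod int (period M))"
    by (simp add: bdm_init_in_states cong_def)
qed

text \<open>Energies are natural numbers, so a least reachable one exists, and its plateau leads to
  the initial state. Both ends lie in phase 0, which makes the total number of steps a multiple of
  the period.\<close>

lemma init_reachable:
  assumes q: "q \<ge> 2" and M: "M \<ge> 1" and s: "s \<in> phase_states M 0"
  shows "\<exists>k. bdm_init M \<in> set_pmf (iterate_kernel (bdm_step M q) (k * period M) (return_pmf s))"
proof -
  let ?L = "int (period M)"
  define e where "e = (LEAST e. lowest_reachable M q s e \<noteq> {})"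
  have "s \<in> lowest_reachable M q s (bdm_energy s)"
    unfolding lowest_reachable_def by (auto intro: exI[of _ 0])
  then have "\<exists>e. lowest_reachable M q s e \<noteq> {}" by auto
  then have ne: "lowest_reachable M q s e \<noteq> {}" unfolding e_def by (rule LeastI_ex)
  have "energy_plateau M q e (lowest_reachable M q s e)"
    using s by (intro lowest_reachable_plateau[OF q]) (auto simp: e_def phase_states_def intro: Least_le)
  moreover obtain x where x: "x \<in> lowest_reachable M q s e" using ne by (meson ex_in_conv)
  moreover from x obtain m where m: "x \<in> set_pmf (iterate_kernel (bdm_step M q) m (return_pmf s))"
    unfolding lowest_reachable_def mem_Collect_eq by (elim conjE exE)
  moreover define n where "n = nat (- clock M x mod ?L)"
  moreover have "[clock M x + int n = 0] (mod ?L)"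
    by (simp add: n_def cong_def mod_simps period_def)
  ultimately have "bdm_init M \<in> set_pmf (iterate_kernel (bdm_step M q) n (return_pmf x))"
    using plateau_reaches_init[OF q M] by blast
  then have reach: "bdm_init M \<in> set_pmf (iterate_kernel (bdm_step M q) (m + n) (return_pmf s))"
    using set_iterate_kernel_add[OF m] by blast
  then have "bdm_init M \<in> phase_states M (m + n)"
    using iterate_kernel_in_phase[OF q s] by simp
  then have "period M dvd m + n"
    by (simp add: phase_states_def bdm_init_in_states cong_sym_eq[of 0] cong_0_iff del: of_nat_add)
  then obtain k where "m + n = k * period M" by (metis dvdE mult.commute)
  then show ?thesis using reach by auto
qed

section \<open>The limit distribution and its symmetry\<close>

lemma pmf_le_pmf_map: "pmf p x \<le> pmf (map_pmf f p) (f x)"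
proof -
  have "measure_pmf.prob p {x} \<le> measure_pmf.prob p (f -` {f x})"
    by (intro measure_pmf.finite_measure_mono) auto
  then show ?thesis by (simp add: pmf_map measure_pmf_single)
qed

text \<open>A reference law with explicit exponential tails: up to a constant, products of it
  dominate the weight, whose sum is then bounded by a total mass of one. Zero arises with both
  signs.\<close>

definition two_sided_geometric_pmf :: "int pmf" where
  "two_sided_geometric_pmf = map_pmf (\<lambda>(b, n). if b then int n else - int n)
     (pair_pmf (bernoulli_pmf (1/2)) (geometric_pmf (1/2)))"

lemma two_sided_geometric_pmf_ge:
  "(1/2) ^ (nat \<bar>x\<bar> + 2) \<le> pmf two_sided_geometric_pmf x"
proof -
  have "(\<lambda>(b, n). if b then int n else - int n) (x \<ge> 0, nat \<bar>x\<bar>) = x" by auto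
  moreover have "pmf (pair_pmf (bernoulli_pmf (1/2)) (geometric_pmf (1/2))) (x \<ge> 0, nat \<bar>x\<bar>) = (1/2) ^ (nat \<bar>x\<bar> + 2)"
    by (cases "x \<ge> 0") (simp_all add: pmf_pair)
  ultimately show ?thesis
    using pmf_le_pmf_map[of _ "(x \<ge> 0, nat \<bar>x\<bar>)" "\<lambda>(b, n). if b then int n else - int n"]
    unfolding two_sided_geometric_pmf_def by metis
qed

lemma replicate_pmf_ge:
  "(\<Prod>x\<leftarrow>xs. pmf p x) \<le> pmf (replicate_pmf (length xs) p) xs"
proof (induction xs)
  case (Cons x xs)
  have "replicate_pmf (Suc n) p = map_pmf (\<lambda>(x, xs). x # xs) (pair_pmf p (replicate_pmf n p))" for n
    by (simp add: pair_pmf_def map_bind_pmf bind_assoc_pmf bind_return_pmf)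
  then have "pmf p x * pmf (replicate_pmf (length xs) p) xs \<le> pmf (replicate_pmf (length (x # xs)) p) (x # xs)"
    using pmf_le_pmf_map[of "pair_pmf p (replicate_pmf (length xs) p)" "(x, xs)" "\<lambda>(x, xs). x # xs"]
    by (simp add: pmf_pair)
  moreover have "pmf p x * (\<Prod>x\<leftarrow>xs. pmf p x) \<le> pmf p x * pmf (replicate_pmf (length xs) p) xs"
    using Cons by (intro mult_left_mono) auto
  ultimately show ?case by simp
qed simp

lemma half_power_sum_le:
  "(1/2 :: real) ^ ((\<Sum>x\<leftarrow>xs. nat \<bar>x\<bar>) + 2 * length xs) \<le> (\<Prod>x\<leftarrow>xs. pmf two_sided_geometric_pmf x)"
proof (induction xs)
  case (Cons x xs)
  have "(1/2 :: real) ^ ((\<Sum>x\<leftarrow>x # xs. nat \<bar>x\<bar>) + 2 * length (x # xs))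
      = (1/2) ^ (nat \<bar>x\<bar> + 2) * (1/2) ^ ((\<Sum>x\<leftarrow>xs. nat \<bar>x\<bar>) + 2 * length xs)"
    by (simp add: power_add)
  also have "\<dots> \<le> pmf two_sided_geometric_pmf x * (\<Prod>x\<leftarrow>xs. pmf two_sided_geometric_pmf x)"
    by (intro mult_mono two_sided_geometric_pmf_ge Cons) auto
  finally show ?case by simp
qed simp

text \<open>The pairs with the last letter alone control all offsets; the asymmetry of
  \<open>pair_energy\<close> costs at most one per letter.\<close>

lemma sum_abs_diff_le_energy:
  "(\<Sum>x\<leftarrow>map (\<lambda>b. b - d) bs. nat \<bar>x\<bar>) \<le> energy (bs @ [d]) + length bs"
proof -
  have "(\<Sum>b\<leftarrow>bs. nat \<bar>b - d\<bar>) \<le> (\<Sum>b\<leftarrow>bs. pair_energy b d + 1)"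
    by (intro sum_list_mono) (auto simp: pair_energy_def)
  also have "\<dots> = (\<Sum>b\<leftarrow>bs. pair_energy b d) + length bs"
    by (induction bs) auto
  finally show ?thesis by (simp add: energy_append o_def)
qed

definition offsets :: "bdm_state \<Rightarrow> int list" where
  "offsets s = (case s of (bs, d, T, t) \<Rightarrow> map (\<lambda>b. b - d) bs)"

lemma phase_0_states:
  "s \<in> phase_states M 0 \<Longrightarrow> \<exists>bs d. s = (bs, d, 0, Suc M) \<and> length bs = M \<and> d + sum_list bs = 0"
proof -
  assume s: "s \<in> phase_states M 0"
  obtain bs d T t where st: "s = (bs, d, T, t)" by (cases s)
  have "T = 0 \<and> t = M + 1"
    using clock_cong_imp_eq[of bs d T t M "replicate M 0" 0 0 "M + 1"] s bdm_init_in_states[of M]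
    by (simp add: st bdm_init_def phase_states_def)
  then show ?thesis using s by (simp add: st phase_states_def mem_bdm_states)
qed

text \<open>On phase 0 the offsets add up to -(M + 1) d, so they determine \<open>d\<close> and with
  it all letters.\<close>

lemma inj_on_offsets: "inj_on offsets (phase_states M 0)"
proof (rule inj_onI)
  fix s s' assume "s \<in> phase_states M 0" "s' \<in> phase_states M 0" and eq: "offsets s = offsets s'"
  then obtain bs d bs' d' where s: "s = (bs, d, 0, Suc M)" "length bs = M" "d + sum_list bs = 0"
    and s': "s' = (bs', d', 0, Suc M)" "length bs' = M" "d' + sum_list bs' = 0"
    by (meson phase_0_states)
  have map_eq: "map (\<lambda>b. b + - d) bs = map (\<lambda>b. b + - d') bs'"
    using eq by (simp add: offsets_def s s')
  then have "sum_list bs + int M * (- d) = sum_list bs' + int M * (- d')"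
    using sum_list_map_add_const[of "- d" bs] sum_list_map_add_const[of "- d'" bs'] s s' by simp
  then have "(int M + 1) * d = (int M + 1) * d'" using s(3) s'(3) by (simp add: algebra_simps)
  then have "d = d'" by simp
  then have "bs = bs'" using map_eq by (auto dest: map_injective simp: inj_def)
  then show "s = s'" using s s' \<open>d = d'\<close> by simp
qed

lemma weight_le_offsets:
  assumes q: "q \<ge> 2" and s: "s \<in> phase_states M 0"
  shows "weight q s \<le> 8 ^ M * pmf (replicate_pmf M two_sided_geometric_pmf) (offsets s)"
proof -
  obtain bs d where st: "s = (bs, d, 0, Suc M)" and len: "length bs = M"
    using phase_0_states[OF s] by blast
  let ?N = "\<Sum>x\<leftarrow>offsets s. nat \<bar>x\<bar>"
  have "1 / real q \<le> 1/2" using q by (simp add: field_simps)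
  then have "weight q s \<le> (1/2) ^ bdm_energy s"
    unfolding weight_def by (intro power_mono) auto
  \<comment> \<open>Of the 3 M extra factors 1/2, M pay for passing from energy to offsets and 2 M
    for the lower bound on the geometric masses.\<close>
  also have "\<dots> = 8 ^ M * (1/2) ^ (bdm_energy s + 3 * M)"
    by (simp add: power_add power_mult power_divide flip: power_mult_distrib)
  also have "\<dots> \<le> 8 ^ M * (1/2) ^ (?N + 2 * M)"
    using sum_abs_diff_le_energy[of d bs] len
    by (intro mult_left_mono power_decreasing) (auto simp: st bdm_energy_def arrangement_def offsets_def)
  also have "\<dots> \<le> 8 ^ M * pmf (replicate_pmf M two_sided_geometric_pmf) (offsets s)"
    using half_power_sum_le[of "offsets s"] replicate_pmf_ge[of two_sided_geometric_pmf "offsets s"] len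
    by (intro mult_left_mono) (auto simp: st offsets_def)
  finally show ?thesis .
qed

definition partition_sum :: "nat \<Rightarrow> nat \<Rightarrow> ennreal" where
  "partition_sum M q = (\<integral>\<^sup>+s. ennreal (weight q s) \<partial>count_space (phase_states M 0))"

lemma partition_sum_finite:
  assumes "q \<ge> 2"
  shows "partition_sum M q < \<top>"
proof -
  let ?p = "replicate_pmf M two_sided_geometric_pmf"
  have "partition_sum M q \<le> (\<integral>\<^sup>+s. ennreal (8 ^ M) * ennreal (pmf ?p (offsets s)) \<partial>count_space (phase_states M 0))"
    unfolding partition_sum_def
    by (intro nn_integral_mono) (auto simp flip: ennreal_mult intro!: ennreal_leI weight_le_offsets assms)
  also have "\<dots> = ennreal (8 ^ M) * (\<integral>\<^sup>+s. ennreal (pmf ?p (offsets s)) \<partial>count_space (phase_states M 0))"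
    by (simp add: nn_integral_cmult)
  also have "(\<integral>\<^sup>+s. ennreal (pmf ?p (offsets s)) \<partial>count_space (phase_states M 0))
      = emeasure ?p (offsets ` phase_states M 0)"
    by (subst nn_integral_bij_count_space[OF inj_on_imp_bij_betw[OF inj_on_offsets]])
       (rule nn_integral_pmf)
  also have "ennreal (8 ^ M) * emeasure ?p (offsets ` phase_states M 0) < \<top>"
    by (simp add: measure_pmf.emeasure_eq_measure ennreal_mult_less_top del: ennreal_power ennreal_numeral)
  finally show ?thesis .
qed

lemma bdm_init_in_phase_0: "bdm_init M \<in> phase_states M 0"
  by (simp add: phase_states_def bdm_init_in_states)

section \<open>Normalisation and the limit superior\<close>

lemma stationary_distribution_exists:
  assumes q: "q \<ge> 2"
  obtains r c where "c > 0" "\<And>s. pmf r s = (if s \<in> phase_states M 0 then c * weight q s else 0)"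
proof -
  define Z where "Z = enn2real (partition_sum M q)"
  have Z: "ennreal Z = partition_sum M q"
    using partition_sum_finite[OF q] by (simp add: Z_def)
  \<comment> \<open>The initial state has weight 1, which keeps the normalising sum away from
    0.\<close>
  have "1 = (\<integral>\<^sup>+s. indicator {bdm_init M} s \<partial>count_space (phase_states M 0))"
    by (simp add: bdm_init_in_phase_0)
  also have "\<dots> \<le> partition_sum M q"
    unfolding partition_sum_def
    by (intro nn_integral_mono) (auto simp: indicator_def weight_def bdm_init_in_states)
  finally have "Z \<ge> 1" by (simp flip: Z)
  let ?f = "\<lambda>s. if s \<in> phase_states M 0 then 1 / Z * weight q s else 0"
  have nonneg: "?f s \<ge> 0" for s using \<open>Z \<ge> 1\<close> by (simp add: weight_def)
  have "(\<integral>\<^sup>+s. ennreal (?f s) \<partial>count_space UNIV)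
      = (\<integral>\<^sup>+s. ennreal (1 / Z * weight q s) \<partial>count_space (phase_states M 0))"
    by (subst nn_integral_count_space_indicator) (auto intro!: nn_integral_cong)
  also have "\<dots> = ennreal (1 / Z) * ennreal Z"
    using \<open>Z \<ge> 1\<close> unfolding Z partition_sum_def
    by (subst nn_integral_cmult[symmetric]) (auto simp: weight_def simp flip: ennreal_mult)
  also have "\<dots> = 1" using \<open>Z \<ge> 1\<close> by (simp flip: ennreal_mult)
  finally have "pmf (embed_pmf ?f) s = ?f s" for s
    by (intro pmf_embed_pmf nonneg)
  then show thesis using \<open>Z \<ge> 1\<close> by (intro that[of "1 / Z" "embed_pmf ?f"]) auto
qed

lemma bdm_dist_iterate: "bdm_dist M q n = iterate_kernel (bdm_step M q) n (return_pmf (bdm_init M))"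
  by (induction n) simp_all

text \<open>The comparison sequence \<open>?f\<close> equals \<open>c * weight q s\<close> at the
  times in the phase of \<open>s\<close> and 0 at all others. It bounds the limit superior from
  above at all times, and from below along the times in that phase.\<close>

lemma bdm_mu_inf_proportional:
  assumes q: "q \<ge> 2" and M: "M \<ge> 1"
  obtains c where "\<And>s. s \<in> bdm_states M \<Longrightarrow> bdm_mu_inf M q s = ennreal (c * weight q s)"
proof -
  let ?K = "bdm_step M q" and ?L = "period M"
  have L: "?L > 0" by (simp add: period_def)
  obtain r c where c: "c > 0" and r: "\<And>s. pmf r s = (if s \<in> phase_states M 0 then c * weight q s else 0)"
    using stationary_distribution_exists[OF q] by blast
  have w: "weight q s > 0" for s using q by (simp add: weight_def)
  have iter: "pmf (iterate_kernel ?K n r) s = (if s \<in> phase_states M n then c * weight q s else 0)" for n s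
    by (induction n arbitrary: s) (auto simp only: iterate_kernel.simps r bind_phase_distribution[OF q])
  have "phase_states M ?L = phase_states M 0"
    by (auto simp: phase_states_def cong_def)
  then have per: "iterate_kernel ?K ?L r = r"
    by (intro pmf_eqI) (simp add: iter r)
  have tends: "(\<lambda>n. pmf (iterate_kernel ?K n (return_pmf (bdm_init M))) s - pmf (iterate_kernel ?K n r) s) \<longlonglongrightarrow> 0" for s
  proof (rule iterate_kernel_tendsto_periodic[OF per L])
    \<comment> \<open>The initial state has weight 1, so its mass under \<open>r\<close> is exactly
      \<open>c\<close>.\<close>
    show "pmf (return_pmf (bdm_init M)) x \<le> 1 / c * pmf r x" for x
      using c w[of x] bdm_init_in_phase_0[of M]
      by (auto simp: r indicator_def weight_def bdm_init_in_states)
    show "1 / c \<ge> 0" using c by simp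
    show "bdm_init M \<in> set_pmf (iterate_kernel ?K ?L (return_pmf (bdm_init M)))"
      by (rule init_returns[OF q M])
    fix x assume "x \<in> set_pmf r"
    then have "x \<in> phase_states M 0" by (auto simp: set_pmf_iff r split: if_splits)
    then show "\<exists>k. bdm_init M \<in> set_pmf (iterate_kernel ?K (k * ?L) (return_pmf x))"
      by (rule init_reachable[OF q M])
  qed
  have "bdm_mu_inf M q s = ennreal (c * weight q s)" if s: "s \<in> bdm_states M" for s
  proof (rule antisym)
    let ?f = "\<lambda>n. pmf (iterate_kernel ?K n r) s"
    have diff: "(\<lambda>n. bdm_mu M q n s - ?f n) \<longlonglongrightarrow> 0"
      using tends by (simp add: bdm_mu_def bdm_dist_iterate)
    show "bdm_mu_inf M q s \<le> ennreal (c * weight q s)"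
    proof (rule ennreal_le_epsilon)
      fix e :: real assume "e > 0"
      then have "\<forall>\<^sub>F n in sequentially. bdm_mu M q n s - ?f n < e"
        using diff by (intro order_tendstoD(2)) auto
      then have "\<forall>\<^sub>F n in sequentially. ennreal (bdm_mu M q n s) \<le> ennreal (c * weight q s) + ennreal e"
      proof eventually_elim
        case (elim n)
        have "?f n \<le> c * weight q s" using c w[of s] by (simp add: iter)
        then have "bdm_mu M q n s \<le> c * weight q s + e" using elim by linarith
        then show ?case using c w[of s] \<open>e > 0\<close> by (simp add: ennreal_leI flip: ennreal_plus)
      qed
      then show "bdm_mu_inf M q s \<le> ennreal (c * weight q s) + ennreal e"
        unfolding bdm_mu_inf_def by (rule Limsup_bounded)
    qed
    define g where "g k = nat (clock M s mod int ?L) + k * ?L" for k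
    have g: "strict_mono g" using L by (simp add: g_def strict_mono_def)
    have "s \<in> phase_states M (g k)" for k
      using s L by (simp add: phase_states_def g_def cong_def)
    then have fg: "?f (g k) = c * weight q s" for k by (simp add: iter)
    have "(\<lambda>k. bdm_mu M q (g k) s - c * weight q s) \<longlonglongrightarrow> 0"
      using LIMSEQ_subseq_LIMSEQ[OF diff g] by (simp add: o_def fg)
    then have "(\<lambda>k. bdm_mu M q (g k) s) \<longlonglongrightarrow> c * weight q s" by (simp add: LIM_zero_iff)
    then have "(\<lambda>k. ennreal (bdm_mu M q (g k) s)) \<longlonglongrightarrow> ennreal (c * weight q s)"
      by (rule tendsto_ennrealI)
    then have "limsup ((\<lambda>n. ennreal (bdm_mu M q n s)) \<circ> g) = ennreal (c * weight q s)"
      by (intro lim_imp_Limsup) (auto simp: o_def)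
    then show "ennreal (c * weight q s) \<le> bdm_mu_inf M q s"
      unfolding bdm_mu_inf_def using limsup_subseq_mono[OF g] by metis
  qed
  then show thesis by (rule that)
qed

section \<open>The mirror symmetry\<close>

definition mirror :: "nat \<Rightarrow> bdm_state \<Rightarrow> bdm_state" where
  "mirror M s = (case s of (bs, d, T, t) \<Rightarrow> (rev (map (\<lambda>x. - x - 1) bs), - d, int M - T, t))"

lemma mirror_mirror: "mirror M (mirror M s) = s"
  by (cases s) (simp add: mirror_def rev_map o_def)

text \<open>Besides the change of sign, M letters are lowered by one, so the sum condition turns
  \<open>T\<close> into \<open>int M - T\<close>.\<close>

lemma mirror_states:
  assumes "s \<in> bdm_states_fix M T (M + 1) d"
  shows "mirror M s \<in> bdm_states_fix M (int M - T) (M + 1) (- d)"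
proof -
  obtain bs where s: "s = (bs, d, T, M + 1)" "s \<in> bdm_states M"
    using assms by (auto simp: bdm_states_fix_def)
  have "sum_list (map (\<lambda>x. - x - 1) bs) = - sum_list bs - int (length bs)"
    by (induction bs) auto
  then show ?thesis
    using s by (auto simp: bdm_states_fix_def mem_bdm_states mirror_def sum_list_rev)
qed

lemma bij_betw_mirror:
  "bij_betw (mirror M) (bdm_states_fix M T (M + 1) d) (bdm_states_fix M (int M - T) (M + 1) (- d))"
proof (rule bij_betwI[where g = "mirror M"])
  show "mirror M \<in> bdm_states_fix M (int M - T) (M + 1) (- d) \<rightarrow> bdm_states_fix M T (M + 1) d"
    using mirror_states[of _ M "int M - T" "- d"] by auto
  show "mirror M \<in> bdm_states_fix M T (M + 1) d \<rightarrow> bdm_states_fix M (int M - T) (M + 1) (- d)"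
    by (rule funcsetI) (rule mirror_states)
qed (simp_all add: mirror_mirror)

text \<open>Negating and reversing the word puts -d in front; rotating it back to the end raises it
  to -d + 1, and translating by -1 restores -d. This translation is the origin of the -1 in the
  other letters.\<close>

lemma bdm_energy_mirror:
  assumes "length bs = M"
  shows "bdm_energy (mirror M (bs, d, T, M + 1)) = bdm_energy (bs, d, T, M + 1)"
proof -
  let ?bs = "rev (map (\<lambda>x. - x - 1) bs)"
  have "energy (?bs @ [- d]) = energy ((- d - 1) # ?bs)" by (rule energy_rotate[symmetric])
  also have "(- d - 1) # ?bs = rev (map uminus (map (\<lambda>x. x + 1) (bs @ [d])))"
    by (simp add: o_def)
  also have "energy \<dots> = energy (bs @ [d])"
    by (simp only: energy_reverse_negate energy_translate)
  finally show ?thesis using assms by (simp add: bdm_energy_def mirror_def arrangement_def)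
qed

theorem theorem14:
  fixes M q :: nat and d T :: int
  assumes "M \<ge> 1" and "q \<ge> 2" and "0 \<le> T" and "T \<le> int M"
  shows "bdm_gamma M q d T (M + 1) = bdm_gamma M q (- d) (int M - T) (M + 1)"
proof -
  let ?A = "bdm_states_fix M T (M + 1) d" and ?B = "bdm_states_fix M (int M - T) (M + 1) (- d)"
  obtain c where c: "\<And>s. s \<in> bdm_states M \<Longrightarrow> bdm_mu_inf M q s = ennreal (c * weight q s)"
    using bdm_mu_inf_proportional[OF assms(2,1)] by blast
  have "bdm_mu_inf M q s = bdm_mu_inf M q (mirror M s)" if s: "s \<in> ?A" for s
  proof -
    obtain bs where "s = (bs, d, T, M + 1)" "length bs = M"
      using s by (cases s) (auto simp: bdm_states_fix_def mem_bdm_states)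
    then have "weight q (mirror M s) = weight q s"
      by (simp only: weight_def bdm_energy_mirror)
    moreover have "s \<in> bdm_states M" "mirror M s \<in> bdm_states M"
      using s mirror_states[OF s] by (auto simp: bdm_states_fix_def)
    ultimately show ?thesis by (simp add: c)
  qed
  then have "bdm_gamma M q d T (M + 1) = (\<Sum>\<^sub>\<infinity>s\<in>?A. bdm_mu_inf M q (mirror M s))"
    unfolding bdm_gamma_def by (rule infsum_cong)
  also have "\<dots> = bdm_gamma M q (- d) (int M - T) (M + 1)"
    unfolding bdm_gamma_def by (rule infsum_reindex_bij_betw[OF bij_betw_mirror])
  finally show ?thesis .
qed

end
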